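(* The inversor $I:[\frac12,1]\to[\frac12,1]$ of the $A_2$-continued fraction representation of numbers, defined by $$I\left(\Delta^{A_2}_{\left(\frac12\right)^{\alpha_1}\left(\frac12\right)^{\alpha_2}\ldots\left(\frac12\right)^{\alpha_n}\ldots}\right)=\Delta^{A_2}_{\left(\frac12\right)^{1-\alpha_1}\left(\frac12\right)^{1-\alpha_2}\ldots\left(\frac12\right)^{1-\alpha_n}\ldots},\qquad \alpha_n\in\{0,1\},$$ is a singular function.
   Context: Let $A_2=\{\frac12,1\}$. For a sequence $(a_n)_{n\ge1}$ with $a_n\in A_2$, $\Delta^{A_2}_{a_1a_2\ldots a_n\ldots}$ denotes the value of the infinite continued fraction $$[0;a_1,a_2,a_3,\ldots]=\cfrac{1}{a_1+\cfrac{1}{a_2+\cfrac{1}{a_3+\cdots}}},$$ i.e. the limit of its convergents $p_n/q_n$, where $p_n=a_np_{n-1}+p_{n-2}$, $q_n=a_nq_{n-1}+q_{n-2}$ for $n\ge1$, with $p_0=0$, $q_0=1$, $p_{-1}=1$, $q_{-1}=0$. These limits exist and lie in $[\frac12,1]$, and every $x\in[\frac12,1]$ has at least one such representation. The inversor $I$ thus interchanges the digits $\frac12$ and $1$ in every position. It is well-defined: for numbers having two $A_2$-representations, both give the same value of $I$. A function on an interval is called singular if it is continuous, non-constant, and its derivative exists and equals $0$ almost everywhere with respect to Lebesgue measure. *)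

theory Defs
  imports "HOL-Analysis.Analysis"
begin

text \<open>
  A digit sequence \<open>a\<close> is indexed from 1, so \<open>a 0\<close> is never used. The second equation of each
  recursion is the general recursion at \<open>n = 1\<close> with the initial values at index \<open>-1\<close>
  (1 for the numerators, 0 for the denominators) inserted.
\<close>

fun cf_num :: "(nat \<Rightarrow> real) \<Rightarrow> nat \<Rightarrow> real" where
  "cf_num a 0 = 0"
| "cf_num a (Suc 0) = a 1 * cf_num a 0 + 1"
| "cf_num a (Suc (Suc n)) = a (Suc (Suc n)) * cf_num a (Suc n) + cf_num a n"

fun cf_den :: "(nat \<Rightarrow> real) \<Rightarrow> nat \<Rightarrow> real" where
  "cf_den a 0 = 1"
| "cf_den a (Suc 0) = a 1 * cf_den a 0 + 0"
| "cf_den a (Suc (Suc n)) = a (Suc (Suc n)) * cf_den a (Suc n) + cf_den a n"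

definition cf_value :: "(nat \<Rightarrow> real) \<Rightarrow> real" where
  "cf_value a = lim (\<lambda>n. cf_num a n / cf_den a n)"

definition binary_seqs :: "(nat \<Rightarrow> nat) set" where
  "binary_seqs = {\<alpha>. \<forall>n\<ge>1. \<alpha> n \<in> {0, 1}}"

definition Delta_A2 :: "(nat \<Rightarrow> nat) \<Rightarrow> real" where
  "Delta_A2 \<alpha> = cf_value (\<lambda>n. (1/2) ^ \<alpha> n)"

definition inversor :: "real \<Rightarrow> real" where
  "inversor x =
    (THE y. \<exists>\<alpha>\<in>binary_seqs. x = Delta_A2 \<alpha> \<and> y = Delta_A2 (\<lambda>n. 1 - \<alpha> n))"

definition singular_on :: "real set \<Rightarrow> (real \<Rightarrow> real) \<Rightarrow> bool" where
  "singular_on S f \<longleftrightarrow>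
     continuous_on S f \<and>
     \<not> f constant_on S \<and>
     (AE x in lebesgue. x \<in> S \<longrightarrow> (f has_real_derivative 0) (at x within S))"

end

theory Submission
  imports Defs
begin

text \<open>
  The branches \<open>x \<mapsto> 1/(1/2+x)\<close> and \<open>x \<mapsto> 1/(1+x)\<close> map \<open>[1/2, 1]\<close> onto \<open>[2/3, 1]\<close> and
  \<open>[1/2, 2/3]\<close>. The inversor conjugates each branch with the other one, and is the uniform limit
  of the continuous functions obtained by iterating this functional equation on \<open>3/2 - x\<close>; this
  gives both continuity and independence of the representation.

  For singularity, let \<open>l(w)\<close> be the length of the cylinder of a word \<open>w\<close> and \<open>w'\<close> the word with
  the digits interchanged. A transfer operator estimate shows that the sum of \<open>sqrt(l(w) l(w'))\<close>
  over all words of length \<open>n\<close> decays exponentially. By Borel-Cantelli, almost every \<open>x\<close> lies, for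
  all large \<open>n\<close>, in cylinders with \<open>l(w') \<le> (99/100)^(2n) l(w)\<close>, and at a relative distance of order
  at least \<open>(99/100)^n\<close> from the end points of the cylinder. If \<open>y\<close> leaves the cylinders around \<open>x\<close>
  at stage \<open>n\<close>, the difference quotient at \<open>x\<close> and \<open>y\<close> is therefore at most of order \<open>(99/100)^n\<close>.
\<close>

section \<open>Cylinder maps, their derivatives and their contraction\<close>

definition digit :: "bool \<Rightarrow> real" where
  "digit b = (if b then 1/2 else 1)"

text \<open>Words list the digits last one first, so that \<open>b # w\<close> appends the digit \<open>b\<close> to \<open>w\<close>.\<close>

fun cyl_map :: "bool list \<Rightarrow> real \<Rightarrow> real" where
  "cyl_map [] x = x"
| "cyl_map (b # w) x = cyl_map w (1 / (digit b + x))"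

text \<open>The square root of the absolute value of the derivative of \<open>cyl_map w\<close>.\<close>

fun contr :: "bool list \<Rightarrow> real \<Rightarrow> real" where
  "contr [] x = 1"
| "contr (b # w) x = contr w (1 / (digit b + x)) / (digit b + x)"

fun prefix_word :: "(nat \<Rightarrow> bool) \<Rightarrow> nat \<Rightarrow> bool list" where
  "prefix_word b 0 = []"
| "prefix_word b (Suc n) = b (Suc n) # prefix_word b n"

lemma digit_bounds: "1/2 \<le> digit b" "digit b \<le> 1" "0 < digit b"
  by (auto simp: digit_def)

lemma digit_add_pos: "0 \<le> x \<Longrightarrow> 0 < digit b + x"
  using digit_bounds(3)[of b] by linarith

lemma length_prefix_word [simp]: "length (prefix_word b n) = n"
  by (induction n) auto

lemma prefix_word_Not: "prefix_word (\<lambda>n. \<not> b n) n = map Not (prefix_word b n)"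
  by (induction n) auto

lemma branch_mem:
  assumes "x \<in> {1/2..1}"
  shows "1 / (digit b + x) \<in> {1/2..1}"
  using assms by (auto simp: digit_def divide_simps)

lemma cyl_map_mem: "x \<in> {1/2..1} \<Longrightarrow> cyl_map w x \<in> {1/2..1}"
  by (induction w arbitrary: x) (auto simp del: atLeastAtMost_iff simp: branch_mem)

text \<open>A Moebius map of determinant 1 or -1 has the reciprocal of its linear denominator as the
  root of its absolute derivative. A and B are the last two convergent denominators; appending a
  digit turns the pair into \<open>A * digit b + B\<close> and \<open>A\<close>.\<close>

lemma contr_form: "\<exists>A>0. \<exists>B\<ge>0. \<forall>x\<ge>0. contr w x = 1 / (A + B * x)"
proof (induction w)
  case Nil
  show ?case by (rule exI[of _ 1]) (auto intro: exI[of _ 0])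
next
  case (Cons b w)
  then obtain A B where AB: "A > 0" "B \<ge> 0" "\<And>x. x \<ge> 0 \<Longrightarrow> contr w x = 1 / (A + B * x)"
    by blast
  have "contr (b # w) x = 1 / ((A * digit b + B) + A * x)" if "x \<ge> 0" for x
  proof -
    have p: "digit b + x > 0" using that digit_add_pos by blast
    have "contr (b # w) x = 1 / ((A + B * (1 / (digit b + x))) * (digit b + x))"
      using AB(3)[of "1 / (digit b + x)"] p by simp
    also have "(A + B * (1 / (digit b + x))) * (digit b + x) = (A * digit b + B) + A * x"
      using p by (simp add: field_simps)
    finally show ?thesis .
  qed
  moreover have "A * digit b + B > 0"
    using AB digit_bounds(3)[of b] by (simp add: add_pos_nonneg)
  ultimately show ?case using AB(1) by (metis less_imp_le)
qed

lemma contr_pos: "0 \<le> x \<Longrightarrow> 0 < contr w x"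
proof -
  assume x: "0 \<le> x"
  obtain A B where "A > 0" "B \<ge> 0" "\<And>x. x \<ge> 0 \<Longrightarrow> contr w x = 1 / (A + B * x)"
    using contr_form by blast
  then show ?thesis using x by (simp add: add_pos_nonneg)
qed

lemma contr_nonneg: "0 \<le> x \<Longrightarrow> 0 \<le> contr w x"
  using contr_pos less_imp_le by blast

text \<open>Bounded distortion: \<open>A + B * x\<close> with nonnegative coefficients varies at
  most by the factor 2 by which x varies. The smallest value, at 1, is the reference from here
  on.\<close>

lemma contr_bounds:
  assumes "x \<in> {1/2..1}"
  shows "contr w 1 \<le> contr w x" "contr w x \<le> 2 * contr w 1"
proof -
  obtain A B where AB: "A > 0" "B \<ge> 0" "\<And>x. x \<ge> 0 \<Longrightarrow> contr w x = 1 / (A + B * x)"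
    using contr_form by blast
  have x: "1/2 \<le> x" "x \<le> 1" using assms by auto
  have Bx: "B * x \<le> B" "B * (1/2) \<le> B * x"
    using x AB(2) mult_left_mono[of x 1 B] mult_left_mono[of "1/2" x B] by auto
  have e: "contr w 1 = 1 / (A + B)" "contr w x = 1 / (A + B * x)"
    using AB(3)[of 1] AB(3)[of x] x by auto
  have "0 \<le> B * x" using x AB(2) by simp
  then have p: "A + B * x > 0" "A + B > 0" using AB by linarith+
  show "contr w 1 \<le> contr w x"
    unfolding e using p Bx by (intro divide_left_mono) auto
  have "A + B \<le> 2 * (A + B * x)" using Bx AB(1) by (simp add: field_simps)
  then show "contr w x \<le> 2 * contr w 1"
    unfolding e using p by (simp add: field_simps)
qed

lemma contr_Cons_ge: "contr w 1 \<le> 2 * contr (b # w) 1"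
proof -
  have "contr w 1 \<le> contr w (1 / (digit b + 1))"
    by (rule contr_bounds(1)) (rule branch_mem, simp)
  moreover have "0 < contr w 1" by (simp add: contr_pos)
  ultimately show ?thesis
    by (cases b) (auto simp: digit_def)
qed

text \<open>A single branch may expand, as \<open>digit b + x\<close> can be below 1, so the
  induction removes two digits at a time: two denominators multiply to at least 5/4, and 4/5 is
  below \<open>(9/10)^2\<close>. The factor 3 absorbs words of length 1. The range includes 0
  because the convergents arise there.\<close>

lemma contr_le: "0 \<le> x \<Longrightarrow> contr w x \<le> 3 * (9/10) ^ length w"
proof (induction w arbitrary: x rule: induct_list012)
  case 1
  show ?case by simp
next
  case (2 b)
  have "1 / (digit b + x) \<le> 1 / (1/2)"
    using digit_bounds(1)[of b] 2 by (intro divide_left_mono) auto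
  then show ?case by simp
next
  case (3 b c w)
  define y where "y = 1 / (digit b + x)"
  define z where "z = 1 / (digit c + y)"
  have p: "digit b + x > 0" using 3 digit_add_pos by blast
  then have y: "y > 0" by (simp add: y_def)
  then have z: "z > 0" using digit_add_pos[of y c] by (simp add: z_def)
  have "1/4 \<le> digit c * (digit b + x)"
    using mult_mono[of "1/2" "digit c" "1/2" "digit b + x"] digit_bounds(1)[of b]
      digit_bounds(1)[of c] 3 by simp
  moreover have "(digit c + y) * (digit b + x) = digit c * (digit b + x) + 1"
    using p by (simp add: y_def field_simps)
  ultimately have "5/4 \<le> (digit c + y) * (digit b + x)" by linarith
  then have q: "1 / ((digit c + y) * (digit b + x)) \<le> 4/5"
    using divide_left_mono[of "5/4" "(digit c + y) * (digit b + x)" 1] by simp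
  have "contr (b # c # w) x = contr w z * (1 / ((digit c + y) * (digit b + x)))"
    by (simp add: y_def z_def)
  also have "\<dots> \<le> contr w z * (4/5)"
    using q contr_pos[of z w] z by (intro mult_left_mono) auto
  also have "\<dots> \<le> (3 * (9/10) ^ length w) * (4/5)"
    using 3(1)[of z] z by simp
  also have "\<dots> \<le> 3 * (9/10) ^ length (b # c # w)" by simp
  finally show ?case .
qed

text \<open>The difference quotient of a Moebius map is, up to sign, the geometric mean of the
  absolute derivatives at the two points. The sign arises because every branch is
  decreasing.\<close>

lemma cyl_map_diff:
  assumes "0 \<le> x" "0 \<le> y"
  shows "cyl_map w x - cyl_map w y = (-1) ^ length w * (x - y) * contr w x * contr w y"
  using assms
proof (induction w arbitrary: x y)
  case Nil
  show ?case by simp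
next
  case (Cons b w)
  have p: "digit b + x > 0" "digit b + y > 0" using Cons digit_add_pos by blast+
  have "1 / (digit b + x) - 1 / (digit b + y) = - (x - y) / ((digit b + x) * (digit b + y))"
    using p by (simp add: field_simps)
  then show ?case
    using Cons.IH[of "1 / (digit b + x)" "1 / (digit b + y)"] p
    by (simp add: left_diff_distrib right_diff_distrib diff_divide_distrib)
qed

lemma cyl_map_dist:
  assumes "0 \<le> x" "0 \<le> y"
  shows "\<bar>cyl_map w x - cyl_map w y\<bar> = \<bar>x - y\<bar> * contr w x * contr w y"
  using cyl_map_diff[OF assms, of w] contr_pos[of x w] contr_pos[of y w] assms
  by (simp add: abs_mult power_abs)

lemma cyl_map_dist_le:
  assumes "0 \<le> x" "0 \<le> y" "\<bar>x - y\<bar> \<le> 1"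
  shows "\<bar>cyl_map w x - cyl_map w y\<bar> \<le> 9 * (81/100) ^ length w"
proof -
  have "\<bar>x - y\<bar> * contr w x * contr w y
      \<le> 1 * (3 * (9/10) ^ length w) * (3 * (9/10) ^ length w)"
    using assms contr_le[of x w] contr_le[of y w] contr_pos[of x w] contr_pos[of y w]
    by (intro mult_mono) auto
  also have "\<dots> = 9 * ((9/10) ^ length w * (9/10) ^ length w)" by simp
  also have "\<dots> = 9 * (81/100) ^ length w"
    by (simp add: power_mult_distrib[symmetric])
  finally show ?thesis using cyl_map_dist[OF assms(1,2)] by simp
qed

lemma cyl_map_dist_le_unit:
  assumes "x \<in> {1/2..1}" "y \<in> {1/2..1}"
  shows "\<bar>cyl_map w x - cyl_map w y\<bar> \<le> 9 * (81/100) ^ length w"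
  using assms by (intro cyl_map_dist_le) (auto simp: abs_le_iff)

section \<open>Convergents and values of digit sequences\<close>

lemma cyl_bound_LIMSEQ: "(\<lambda>n. 9 * (81/100) ^ n :: real) \<longlonglongrightarrow> 0"
  by (auto intro!: tendsto_eq_intros LIMSEQ_realpow_zero)

text \<open>The argument x stands for the rest of the expansion, so that \<open>x = 0\<close> gives
  the convergents. The index \<open>Suc n\<close> avoids the values at index -1.\<close>

lemma cyl_map_mobius:
  assumes "0 \<le> x"
  shows "cyl_map (prefix_word b (Suc n)) x
    = (cf_num (\<lambda>n. digit (b n)) (Suc n) + x * cf_num (\<lambda>n. digit (b n)) n)
      / (cf_den (\<lambda>n. digit (b n)) (Suc n) + x * cf_den (\<lambda>n. digit (b n)) n)"
  using assms
proof (induction n arbitrary: x)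
  case 0
  then show ?case by (simp add: add.commute)
next
  case (Suc n)
  define d where "d = digit (b (Suc (Suc n))) + x"
  have d: "d > 0" using Suc digit_add_pos by (simp add: d_def)
  have "cyl_map (prefix_word b (Suc (Suc n))) x = cyl_map (prefix_word b (Suc n)) (1 / d)"
    by (simp add: d_def)
  also have "\<dots> = (cf_num (\<lambda>n. digit (b n)) (Suc n) + (1/d) * cf_num (\<lambda>n. digit (b n)) n)
      / (cf_den (\<lambda>n. digit (b n)) (Suc n) + (1/d) * cf_den (\<lambda>n. digit (b n)) n)"
    using d by (intro Suc.IH) simp
  also have "\<dots> = (d * (cf_num (\<lambda>n. digit (b n)) (Suc n) + (1/d) * cf_num (\<lambda>n. digit (b n)) n))
      / (d * (cf_den (\<lambda>n. digit (b n)) (Suc n) + (1/d) * cf_den (\<lambda>n. digit (b n)) n))"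
    using d by (subst mult_divide_mult_cancel_left) auto
  also have "\<dots> = (cf_num (\<lambda>n. digit (b n)) (Suc (Suc n)) + x * cf_num (\<lambda>n. digit (b n)) (Suc n))
      / (cf_den (\<lambda>n. digit (b n)) (Suc (Suc n)) + x * cf_den (\<lambda>n. digit (b n)) (Suc n))"
    using d by (simp add: distrib_left) (simp add: d_def algebra_simps)
  finally show ?case .
qed

text \<open>Cylinders are nested: digits after stage n only move the argument within
  \<open>{1/2..1}\<close>.\<close>

lemma prefix_word_extend:
  assumes "n \<le> m" "x \<in> {1/2..1}"
  shows "\<exists>z\<in>{1/2..1}. cyl_map (prefix_word b m) x = cyl_map (prefix_word b n) z"
  using assms
proof (induction m arbitrary: x rule: dec_induct)
  case base
  then show ?case by blast
next
  case (step m)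
  then show ?case using branch_mem by simp
qed

definition expansion_value :: "(nat \<Rightarrow> bool) \<Rightarrow> real" where
  "expansion_value b = cf_value (\<lambda>n. digit (b n))"

text \<open>Nested cylinders of geometrically decreasing length make the images of 1 a Cauchy
  sequence. The convergents are the images of 0, whose distance from those of 1 obeys the same
  bound.\<close>

lemma expansion_value_LIMSEQ:
  "(\<lambda>n. cyl_map (prefix_word b n) 1) \<longlonglongrightarrow> expansion_value b"
proof -
  let ?X = "\<lambda>n. cyl_map (prefix_word b n) 1"
  have dist: "\<bar>?X m - ?X n\<bar> \<le> 9 * (81/100) ^ n" if "n \<le> m" for m n
    using prefix_word_extend[OF that, of 1 b] cyl_map_dist_le_unit[of _ 1 "prefix_word b n"]
    by fastforce
  have "Cauchy ?X"
  proof (rule metric_CauchyI)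
    fix e :: real assume "e > 0"
    then obtain N where N: "9 * (81/100) ^ N < e / 2"
      using order_tendstoD(2)[OF cyl_bound_LIMSEQ, of "e/2"]
      by (auto simp: eventually_sequentially)
    have "dist (?X m) (?X n) < e" if "m \<ge> N" "n \<ge> N" for m n
      using dist[OF that(1)] dist[OF that(2)] N by (simp add: dist_real_def)
    then show "\<exists>M. \<forall>m\<ge>M. \<forall>n\<ge>M. dist (?X m) (?X n) < e" by blast
  qed
  then obtain L where L: "?X \<longlonglongrightarrow> L"
    using Cauchy_convergent convergent_def by blast
  have "\<bar>cyl_map (prefix_word b n) 0 - ?X n\<bar> \<le> 9 * (81/100) ^ n" for n
    using cyl_map_dist_le[of 0 1 "prefix_word b n"] by simp
  then have "(\<lambda>n. cyl_map (prefix_word b n) 0 - ?X n) \<longlonglongrightarrow> 0"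
    by (intro Lim_null_comparison[OF _ cyl_bound_LIMSEQ]) simp
  then have "(\<lambda>n. cyl_map (prefix_word b n) 0) \<longlonglongrightarrow> L"
    using tendsto_add[OF _ L] by fastforce
  then have "(\<lambda>n. cyl_map (prefix_word b (Suc n)) 0) \<longlonglongrightarrow> L"
    by (rule LIMSEQ_Suc)
  then have "(\<lambda>n. cf_num (\<lambda>n. digit (b n)) (Suc n) / cf_den (\<lambda>n. digit (b n)) (Suc n)) \<longlonglongrightarrow> L"
    by (simp add: cyl_map_mobius del: prefix_word.simps)
  then have "(\<lambda>n. cf_num (\<lambda>n. digit (b n)) n / cf_den (\<lambda>n. digit (b n)) n) \<longlonglongrightarrow> L"
    by (rule LIMSEQ_imp_Suc)
  then have "expansion_value b = L"
    by (simp add: expansion_value_def cf_value_def limI)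
  then show ?thesis using L by simp
qed

lemma continuous_on_cyl_map: "continuous_on {0..} (cyl_map w)"
proof (induction w)
  case Nil
  show ?case by simp
next
  case (Cons b w)
  have p: "digit b + x > 0" if "x \<in> {0..}" for x
    using that digit_add_pos by simp
  have "continuous_on {0..} (cyl_map w \<circ> (\<lambda>x. 1 / (digit b + x)))"
  proof (rule continuous_on_compose)
    show "continuous_on {0..} (\<lambda>x. 1 / (digit b + x))"
      using p by (intro continuous_intros ballI) (metis less_irrefl)
    show "continuous_on ((\<lambda>x. 1 / (digit b + x)) ` {0..}) (cyl_map w)"
      by (intro continuous_on_subset[OF Cons] image_subsetI) (simp add: p less_imp_le)
  qed
  then show ?case by (simp add: o_def)
qed

lemma expansion_value_tail:
  "\<exists>s\<in>{1/2..1}. expansion_value b = cyl_map (prefix_word b n) s"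
proof -
  have "continuous_on {1/2..1} (cyl_map (prefix_word b n))"
    by (rule continuous_on_subset[OF continuous_on_cyl_map]) auto
  then have "closed (cyl_map (prefix_word b n) ` {1/2..1})"
    by (intro compact_imp_closed compact_continuous_image compact_Icc)
  moreover have "\<forall>\<^sub>F m in sequentially. cyl_map (prefix_word b m) 1
      \<in> cyl_map (prefix_word b n) ` {1/2..1}"
  proof (rule eventually_sequentiallyI)
    fix m assume "n \<le> m"
    from prefix_word_extend[OF this, of 1 b]
    show "cyl_map (prefix_word b m) 1 \<in> cyl_map (prefix_word b n) ` {1/2..1}" by auto
  qed
  ultimately have "expansion_value b \<in> cyl_map (prefix_word b n) ` {1/2..1}"
    by (rule Lim_in_closed_set[OF _ _ sequentially_bot expansion_value_LIMSEQ])
  then show ?thesis by blast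
qed

lemma expansion_value_mem: "expansion_value b \<in> {1/2..1}"
  using expansion_value_tail[of b 0] by auto

lemma expansion_value_eqI:
  assumes "\<And>n. \<exists>s\<in>{1/2..1}. x = cyl_map (prefix_word b n) s"
  shows "x = expansion_value b"
proof -
  have "\<bar>x - expansion_value b\<bar> \<le> 9 * (81/100) ^ n" for n
  proof -
    obtain s t where st: "s \<in> {1/2..1}" "t \<in> {1/2..1}"
        "x = cyl_map (prefix_word b n) s" "expansion_value b = cyl_map (prefix_word b n) t"
      using assms[of n] expansion_value_tail[of b n] by blast
    show ?thesis using cyl_map_dist_le_unit[OF st(1,2), of "prefix_word b n"] st(3,4) by simp
  qed
  then have "\<bar>x - expansion_value b\<bar> \<le> 0"
    by (intro LIMSEQ_le_const[OF cyl_bound_LIMSEQ]) auto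
  then show ?thesis by simp
qed

section \<open>Existence of expansions by iterating the expanding map\<close>

fun tail :: "real \<Rightarrow> nat \<Rightarrow> real" where
  "tail x 0 = x"
| "tail x (Suc n) = 1 / tail x n - digit (tail x n \<ge> 2/3)"

lemma tail_mem:
  assumes "x \<in> {1/2..1}"
  shows "tail x n \<in> {1/2..1}"
proof (induction n)
  case 0
  show ?case using assms by simp
next
  case (Suc n)
  then show ?case by (auto simp: digit_def divide_simps)
qed

text \<open>Digits are indexed from 1, so digit n is read off the tail after \<open>n - 1\<close>
  steps. At \<open>2/3\<close>, where both digits are possible, 1/2 is chosen.\<close>

definition expand :: "real \<Rightarrow> nat \<Rightarrow> bool" where
  "expand x n = (tail x (n - 1) \<ge> 2/3)"

lemma cyl_map_tail:
  assumes "x \<in> {1/2..1}"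
  shows "cyl_map (prefix_word (expand x) n) (tail x n) = x"
  by (induction n) (auto simp: expand_def)

lemma expansion_value_expand:
  assumes "x \<in> {1/2..1}"
  shows "expansion_value (expand x) = x"
proof (rule expansion_value_eqI[symmetric])
  show "\<exists>s\<in>{1/2..1}. x = cyl_map (prefix_word (expand x) n) s" for n
    using tail_mem[OF assms] cyl_map_tail[OF assms, symmetric] by (rule bexI[rotated])
qed

section \<open>Continuous approximations of the inversor\<close>

fun approx_inv :: "nat \<Rightarrow> real \<Rightarrow> real" where
  "approx_inv 0 x = 3/2 - x"
| "approx_inv (Suc n) x =
    1 / (digit (x < 2/3) + approx_inv n (1 / x - digit (x \<ge> 2/3)))"

lemma approx_inv_mem:
  assumes "x \<in> {1/2..1}"
  shows "approx_inv n x \<in> {1/2..1}"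
  using assms
proof (induction n arbitrary: x)
  case 0
  then show ?case by auto
next
  case (Suc n)
  have "1 / x - digit (x \<ge> 2/3) \<in> {1/2..1}"
    using Suc.prems by (auto simp: digit_def divide_simps)
  from branch_mem[OF Suc.IH[OF this]] show ?case by simp
qed

text \<open>The start \<open>3/2 - x\<close> is chosen to swap the end points, and each step
  preserves this. It makes the two branch formulas agree at \<open>2/3\<close>, whose preimages
  under the branches are 1 and 1/2.\<close>

lemma approx_inv_ends: "approx_inv n (1/2) = 1" "approx_inv n 1 = 1/2"
  by (induction n) (auto simp: digit_def)

text \<open>The two branches meet only at \<open>2/3\<close>, where both formulas give \<open>2/3\<close>.\<close>

lemma approx_inv_branch:
  assumes "s \<in> {1/2..1}"
  shows "approx_inv (Suc n) (1 / (digit b + s)) = 1 / (digit (\<not> b) + approx_inv n s)"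
proof (cases b)
  case True
  then have "2/3 \<le> 1 / (digit b + s)" using assms by (auto simp: digit_def divide_simps)
  then show ?thesis using True by simp
next
  case False
  show ?thesis
  proof (cases "s = 1/2")
    case True
    show ?thesis unfolding True using False by (simp add: digit_def approx_inv_ends)
  next
    case s: False
    then have "1 / (digit b + s) < 2/3" using False assms by (auto simp: digit_def divide_simps)
    then show ?thesis using False by simp
  qed
qed

text \<open>The last digit acts innermost. Peeling it off leaves the shorter word with
  \<open>Suc n\<close> in place of n, hence the general n in the induction.\<close>

lemma approx_inv_cyl_map:
  assumes "s \<in> {1/2..1}"
  shows "approx_inv (length w + n) (cyl_map w s) = cyl_map (map Not w) (approx_inv n s)"
  using assms
proof (induction w arbitrary: n s)
  case Nil
  show ?case by simp
next
  case (Cons b w)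
  have "approx_inv (length w + Suc n) (cyl_map w (1 / (digit b + s)))
      = cyl_map (map Not w) (approx_inv (Suc n) (1 / (digit b + s)))"
    by (rule Cons.IH) (rule branch_mem[OF Cons.prems])
  then show ?case using approx_inv_branch[OF Cons.prems] by simp
qed

lemma continuous_on_approx_inv: "continuous_on {1/2..1} (approx_inv n)"
proof (induction n)
  case 0
  show ?case by (auto intro!: continuous_intros)
next
  case (Suc n)
  \<comment> \<open>Each branch formula stays valid up to and including \<open>2/3\<close>, so the
    two pieces are closed and can be glued.\<close>
  have br: "continuous_on S (approx_inv (Suc n))"
    if S: "\<And>x. x \<in> S \<Longrightarrow> 1/2 \<le> x \<and> 1 / x - digit b \<in> {1/2..1}" for b S
  proof -
    have "approx_inv (Suc n) x = 1 / (digit (\<not> b) + approx_inv n (1 / x - digit b))" if "x \<in> S" for x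
      using approx_inv_branch[of "1 / x - digit b" n b] S[OF that] by simp
    moreover have "continuous_on S (\<lambda>x. 1 / (digit (\<not> b) + approx_inv n (1 / x - digit b)))"
    proof (intro continuous_intros ballI)
      show "continuous_on S (\<lambda>x. approx_inv n (1 / x - digit b))"
      proof (rule continuous_on_compose2[OF Suc])
        show "continuous_on S (\<lambda>x. 1 / x - digit b)"
          using S by (intro continuous_intros) force
      qed (use S in blast)
      fix x assume "x \<in> S"
      then have "approx_inv n (1 / x - digit b) \<in> {1/2..1}" using S approx_inv_mem by blast
      then show "digit (\<not> b) + approx_inv n (1 / x - digit b) \<noteq> 0"
        using digit_bounds(3)[of "\<not> b"] by auto
    qed
    ultimately show ?thesis by (simp cong: continuous_on_cong del: approx_inv.simps)
  qed
  have "continuous_on {1/2..2/3} (approx_inv (Suc n))"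
    by (rule br[of _ False]) (auto simp: digit_def divide_simps)
  moreover have "continuous_on {2/3..1} (approx_inv (Suc n))"
    by (rule br[of _ True]) (auto simp: digit_def divide_simps)
  ultimately have "continuous_on ({1/2..2/3} \<union> {2/3..1}) (approx_inv (Suc n))"
    by (intro continuous_on_closed_Un) auto
  moreover have "{1/2..2/3} \<union> {2/3..1} = {1/2..1::real}" by auto
  ultimately show ?case by simp
qed

text \<open>After n steps the first n digits have been interchanged, so both points lie in the
  cylinder of the interchanged word.\<close>

lemma approx_inv_expansion:
  "\<bar>approx_inv n (expansion_value b) - expansion_value (\<lambda>n. \<not> b n)\<bar> \<le> 9 * (81/100) ^ n"
proof -
  obtain s where s: "s \<in> {1/2..1}" "expansion_value b = cyl_map (prefix_word b n) s"
    using expansion_value_tail by blast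
  obtain t where t: "t \<in> {1/2..1}"
      "expansion_value (\<lambda>n. \<not> b n) = cyl_map (map Not (prefix_word b n)) t"
    using expansion_value_tail[of "\<lambda>n. \<not> b n" n] by (auto simp: prefix_word_Not)
  have "approx_inv n (expansion_value b) = cyl_map (map Not (prefix_word b n)) (approx_inv 0 s)"
    using approx_inv_cyl_map[OF s(1), of "prefix_word b n" 0] s(2) by simp
  then show ?thesis
    using cyl_map_dist_le_unit[OF approx_inv_mem[OF s(1)] t(1), of "map Not (prefix_word b n)" 0] t(2)
    by simp
qed

lemma approx_inv_LIMSEQ:
  "(\<lambda>n. approx_inv n (expansion_value b)) \<longlonglongrightarrow> expansion_value (\<lambda>n. \<not> b n)"
proof -
  have "(\<lambda>n. approx_inv n (expansion_value b) - expansion_value (\<lambda>n. \<not> b n)) \<longlonglongrightarrow> 0"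
    by (rule Lim_null_comparison[OF _ cyl_bound_LIMSEQ]) (use approx_inv_expansion in auto)
  then show ?thesis by (simp add: LIM_zero_iff)
qed

section \<open>The inversor: well-definedness, functional equation, continuity\<close>

lemma cf_value_cong:
  assumes "\<And>n. n \<ge> 1 \<Longrightarrow> a n = a' n"
  shows "cf_value a = cf_value a'"
proof -
  have "cf_num a n = cf_num a' n" for n
    by (induction n rule: induct_nat_012) (auto simp: assms)
  moreover have "cf_den a n = cf_den a' n" for n
    by (induction n rule: induct_nat_012) (auto simp: assms)
  ultimately show ?thesis by (simp add: cf_value_def)
qed

text \<open>The recursions read digits from index 1 on, exactly where \<open>binary_seqs\<close>
  makes the natural subtraction \<open>1 - \<alpha> n\<close> a genuine complement.\<close>

lemma Delta_A2_eq:
  assumes "\<alpha> \<in> binary_seqs"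
  shows "Delta_A2 \<alpha> = expansion_value (\<lambda>n. \<alpha> n = 1)"
    and "Delta_A2 (\<lambda>n. 1 - \<alpha> n) = expansion_value (\<lambda>n. \<alpha> n \<noteq> 1)"
  unfolding Delta_A2_def expansion_value_def
  by (rule cf_value_cong, use assms in \<open>force simp: binary_seqs_def digit_def\<close>)+

text \<open>The limit of \<open>approx_inv n x\<close> depends on the number x alone, so two
  representations of x cannot lead to different images.\<close>

lemma inversor_expansion: "inversor (expansion_value b) = expansion_value (\<lambda>n. \<not> b n)"
  unfolding inversor_def
proof (rule the_equality)
  have "(\<lambda>n. of_bool (b n)) \<in> binary_seqs" by (auto simp: binary_seqs_def)
  from this Delta_A2_eq[OF this]
  show "\<exists>\<alpha>\<in>binary_seqs. expansion_value b = Delta_A2 \<alpha>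
      \<and> expansion_value (\<lambda>n. \<not> b n) = Delta_A2 (\<lambda>n. 1 - \<alpha> n)"
    by (intro bexI[of _ "\<lambda>n. of_bool (b n)"]) auto
next
  fix y
  assume "\<exists>\<alpha>\<in>binary_seqs. expansion_value b = Delta_A2 \<alpha> \<and> y = Delta_A2 (\<lambda>n. 1 - \<alpha> n)"
  then obtain c where "expansion_value b = expansion_value c" "y = expansion_value (\<lambda>n. \<not> c n)"
    using Delta_A2_eq by auto
  then show "y = expansion_value (\<lambda>n. \<not> b n)"
    using approx_inv_LIMSEQ[of b] approx_inv_LIMSEQ[of c] LIMSEQ_unique by metis
qed

lemma approx_inv_inversor:
  assumes "x \<in> {1/2..1}"
  shows "\<bar>approx_inv n x - inversor x\<bar> \<le> 9 * (81/100) ^ n"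
  using approx_inv_expansion[of n "expand x"] inversor_expansion[of "expand x"]
    expansion_value_expand[OF assms] by simp

lemma approx_inv_tendsto_inversor:
  assumes "x \<in> {1/2..1}"
  shows "(\<lambda>n. approx_inv n x) \<longlonglongrightarrow> inversor x"
  using approx_inv_LIMSEQ[of "expand x"] inversor_expansion[of "expand x"]
    expansion_value_expand[OF assms] by simp

lemma inversor_mem: "x \<in> {1/2..1} \<Longrightarrow> inversor x \<in> {1/2..1}"
  using inversor_expansion[of "expand x"] expansion_value_expand[of x]
    expansion_value_mem[of "\<lambda>n. \<not> expand x n"] by simp

text \<open>The exact equation \<open>approx_inv_cyl_map\<close> passes to the limit because
  cylinder maps are continuous.\<close>

lemma inversor_cyl_map:
  assumes "s \<in> {1/2..1}"
  shows "inversor (cyl_map w s) = cyl_map (map Not w) (inversor s)"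
proof (rule LIMSEQ_unique)
  show "(\<lambda>n. approx_inv (n + length w) (cyl_map w s)) \<longlonglongrightarrow> inversor (cyl_map w s)"
    using approx_inv_tendsto_inversor[OF cyl_map_mem[OF assms]] by (rule LIMSEQ_ignore_initial_segment)
  have "continuous_on {1/2..1} (cyl_map (map Not w))"
    by (rule continuous_on_subset[OF continuous_on_cyl_map]) auto
  then have "(\<lambda>n. cyl_map (map Not w) (approx_inv n s)) \<longlonglongrightarrow> cyl_map (map Not w) (inversor s)"
    by (rule continuous_on_tendsto_compose)
      (use assms approx_inv_tendsto_inversor inversor_mem approx_inv_mem in auto)
  then show "(\<lambda>n. approx_inv (n + length w) (cyl_map w s)) \<longlonglongrightarrow> cyl_map (map Not w) (inversor s)"
    using approx_inv_cyl_map[OF assms, of w] by (simp add: add.commute)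
qed

lemma continuous_on_inversor: "continuous_on {1/2..1} inversor"
proof (rule uniform_limit_theorem)
  show "uniform_limit {1/2..1} approx_inv inversor sequentially"
  proof (rule uniform_limitI)
    fix e :: real assume "e > 0"
    then have "\<forall>\<^sub>F n in sequentially. 9 * (81/100) ^ n < e"
      using order_tendstoD(2)[OF cyl_bound_LIMSEQ] by blast
    then show "\<forall>\<^sub>F n in sequentially. \<forall>x\<in>{1/2..1}. dist (approx_inv n x) (inversor x) < e"
      by eventually_elim (auto simp: dist_real_def intro!: le_less_trans[OF approx_inv_inversor])
  qed
qed (auto simp: continuous_on_approx_inv)

lemma inversor_ends: "inversor (1/2) = 1" "inversor 1 = 1/2"
  using approx_inv_tendsto_inversor[of "1/2"] approx_inv_tendsto_inversor[of 1]
  by (auto simp: approx_inv_ends LIMSEQ_const_iff)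

section \<open>Transfer operator estimates for sums over words\<close>

lemma finite_words: "finite {w :: bool list. length w = n}"
  using finite_lists_length_eq[of "UNIV :: bool set" n] by simp

lemma sum_words_Suc:
  "(\<Sum>w | length w = Suc n. f w)
    = (\<Sum>w | length w = n. f (True # w)) + (\<Sum>w | length w = n. f (False # w))"
proof -
  have "{w. length w = Suc n} = (#) True ` {w. length w = n} \<union> (#) False ` {w. length w = n}"
    by (auto simp: length_Suc_conv image_iff)
  moreover have "sum f ((#) True ` {w. length w = n} \<union> (#) False ` {w. length w = n})
      = sum f ((#) True ` {w. length w = n}) + sum f ((#) False ` {w. length w = n})"
    by (intro sum.union_disjoint finite_imageI finite_words) auto
  ultimately show ?thesis by (simp add: sum.reindex)
qed

text \<open>The map whose inverse branches are \<open>x \<mapsto> 1 / (digit b + x)\<close> has the invariant density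
  \<open>1 / ((1 + x) * (2 + x))\<close>.\<close>

lemma sum_contr_sq_le:
  assumes "x \<in> {1/2..1}"
  shows "(\<Sum>w | length w = n. (contr w x)\<^sup>2) \<le> 6 / ((1 + x) * (2 + x))"
  using assms
proof (induction n arbitrary: x)
  case 0
  \<comment> \<open>The constant 6 is the maximum of \<open>(1 + x) * (2 + x)\<close> on the
    interval, so the bound holds for the empty word.\<close>
  then have "(1 + x) * (2 + x) \<le> 2 * 3" by (intro mult_mono) auto
  moreover have "0 < (1 + x) * (2 + x)" using 0 by simp
  ultimately show ?case by simp
next
  case (Suc n)
  let ?y = "\<lambda>b. 1 / (digit b + x)"
  have x: "0 < x" using Suc.prems by simp
  have step: "(\<Sum>w | length w = n. (contr (b # w) x)\<^sup>2)
      \<le> 6 / ((1 + ?y b) * (2 + ?y b)) / (digit b + x)\<^sup>2" for b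
  proof -
    have "(\<Sum>w | length w = n. (contr (b # w) x)\<^sup>2)
        = (\<Sum>w | length w = n. (contr w (?y b))\<^sup>2) / (digit b + x)\<^sup>2"
      by (simp add: power_divide sum_divide_distrib)
    also have "\<dots> \<le> 6 / ((1 + ?y b) * (2 + ?y b)) / (digit b + x)\<^sup>2"
      by (intro divide_right_mono Suc.IH branch_mem Suc.prems) simp
    finally show ?thesis .
  qed
  have dens: "6 / ((1 + 1/z) * (2 + 1/z)) / z\<^sup>2 = 6 / ((z + 1) * (2 * z + 1))" if "z > 0" for z :: real
    using that by (simp add: divide_simps power2_eq_square)
  have "(\<Sum>w | length w = Suc n. (contr w x)\<^sup>2)
      \<le> 6 / ((digit True + x + 1) * (2 * (digit True + x) + 1))
        + 6 / ((digit False + x + 1) * (2 * (digit False + x) + 1))"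
    unfolding sum_words_Suc using step[of True] step[of False] x digit_add_pos[of x]
    by (simp only: dens less_imp_le add_mono)
  also have "\<dots> = 6 / ((x + 3/2) * (2 * x + 2)) + 6 / ((x + 2) * (2 * x + 3))"
    by (simp add: digit_def algebra_simps)
  \<comment> \<open>This identity is the invariance of the density.\<close>
  also have "\<dots> = 6 / ((1 + x) * (2 + x))"
    using x by (simp add: divide_simps) (simp add: algebra_simps)
  finally show ?case .
qed

text \<open>The denominators on the left are \<open>1 + 3/2 * (digit b + t)\<close> for the two
  digits. Multiplied by \<open>(x + 3/2) * (y + 3/2)\<close>, the claim reads
  \<open>A x * B y + B x * A y \<le> 197/200\<close>; at \<open>x = y = 1/2\<close> the left side is
  64/65.\<close>

lemma mixed_weight_bound:
  fixes x y :: real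
  assumes "x \<in> {1/2..1}" "y \<in> {1/2..1}"
  shows "1 / ((7/4 + 3/2 * x) * (5/2 + 3/2 * y)) + 1 / ((5/2 + 3/2 * x) * (7/4 + 3/2 * y))
    \<le> (197/200) / ((x + 3/2) * (y + 3/2))"
proof -
  define A B where "A = (\<lambda>t::real. (t + 3/2) / (7/4 + 3/2 * t))"
    and "B = (\<lambda>t::real. (t + 3/2) / (5/2 + 3/2 * t))"
  \<comment> \<open>A is convex and decreasing; the line starts at its value at 1/2 and is slightly
    flatter than the chord.\<close>
  have A: "0 \<le> A t" "A t \<le> 8/10 - 6/100 * (t - 1/2)" if "t \<in> {1/2..1}" for t
  proof -
    have eq: "(8/10 - 6/100 * (t - 1/2)) * (7/4 + 3/2 * t) - (t + 3/2)
        = 9/100 * ((t - 1/2) * (1 - t)) + 1/200 * (t - 1/2)"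
      by (simp add: field_simps)
    have "0 \<le> 9/100 * ((t - 1/2) * (1 - t)) + 1/200 * (t - 1/2)"
      using that by (intro add_nonneg_nonneg mult_nonneg_nonneg) auto
    then have "t + 3/2 \<le> (8/10 - 6/100 * (t - 1/2)) * (7/4 + 3/2 * t)"
      by (simp only: eq[symmetric] diff_ge_0_iff_ge)
    then show "A t \<le> 8/10 - 6/100 * (t - 1/2)" using that by (simp add: A_def divide_le_eq)
    show "0 \<le> A t" using that by (simp add: A_def)
  qed
  \<comment> \<open>B is concave and increasing; the line lies slightly above the tangent at
    1/2.\<close>
  have B: "0 \<le> B t" "B t \<le> 6154/10000 + 24/1000 * (t - 1/2)" if "t \<in> {1/2..1}" for t
  proof -
    have eq: "(6154/10000 + 24/1000 * (t - 1/2)) * (5/2 + 3/2 * t) - (t + 3/2)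
        = 36/1000 * ((t - 1/2) * (t - 1/2)) + 11/10000 * (t - 1/2) + 5/100000"
      by (simp add: field_simps)
    have "0 \<le> 36/1000 * ((t - 1/2) * (t - 1/2)) + 11/10000 * (t - 1/2) + 5/100000"
      using that by (intro add_nonneg_nonneg mult_nonneg_nonneg) auto
    then have "t + 3/2 \<le> (6154/10000 + 24/1000 * (t - 1/2)) * (5/2 + 3/2 * t)"
      by (simp only: eq[symmetric] diff_ge_0_iff_ge)
    then show "B t \<le> 6154/10000 + 24/1000 * (t - 1/2)" using that by (simp add: B_def divide_le_eq)
    show "0 \<le> B t" using that by (simp add: B_def)
  qed
  have "A x * B y + B x * A y
      \<le> (8/10 - 6/100 * (x - 1/2)) * (6154/10000 + 24/1000 * (y - 1/2))
        + (6154/10000 + 24/1000 * (x - 1/2)) * (8/10 - 6/100 * (y - 1/2))"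
    using assms A[of x] A[of y] B[of x] B[of y] by (intro add_mono mult_mono) auto
  also have "\<dots> \<le> 197/200"
  proof -
    have eq: "197/200 - ((8/10 - 6/100 * (x - 1/2)) * (6154/10000 + 24/1000 * (y - 1/2))
        + (6154/10000 + 24/1000 * (x - 1/2)) * (8/10 - 6/100 * (y - 1/2)))
        = 288/100000 * ((x - 1/2) * (y - 1/2))
          + 17724/1000000 * ((x - 1/2) + (y - 1/2)) + 36/100000"
      by (simp add: field_simps)
    have "0 \<le> 288/100000 * ((x - 1/2) * (y - 1/2))
          + 17724/1000000 * ((x - 1/2) + (y - 1/2)) + 36/100000"
      using assms by (intro add_nonneg_nonneg mult_nonneg_nonneg) auto
    then show ?thesis
      by (simp only: eq[symmetric] diff_ge_0_iff_ge)
  qed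
  finally have "(A x * B y + B x * A y) / ((x + 3/2) * (y + 3/2))
      \<le> (197/200) / ((x + 3/2) * (y + 3/2))"
    using assms by (intro divide_right_mono) auto
  moreover have "(A x * B y + B x * A y) / ((x + 3/2) * (y + 3/2))
      = 1 / ((7/4 + 3/2 * x) * (5/2 + 3/2 * y)) + 1 / ((5/2 + 3/2 * x) * (7/4 + 3/2 * y))"
  proof -
    have "A t / (t + 3/2) = 1 / (7/4 + 3/2 * t)" "B t / (t + 3/2) = 1 / (5/2 + 3/2 * t)"
      if "t \<in> {1/2..1}" for t
      using that by (simp_all add: A_def B_def)
    with assms show ?thesis
      by (simp only: add_divide_distrib times_divide_times_eq[symmetric]) simp
  qed
  ultimately show ?thesis by simp
qed

text \<open>The transfer operator that pairs each branch with the branch of the opposite digit shrinks the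
  weight \<open>1 / ((x + 3/2) * (y + 3/2))\<close> by the factor \<open>197/200\<close>. Here \<open>1 / (x + 3/2)\<close> is a rational
  substitute for the square root of the invariant density.\<close>

lemma sum_contr_Not_le:
  assumes "x \<in> {1/2..1}" "y \<in> {1/2..1}"
  shows "(\<Sum>w | length w = n. contr w x * contr (map Not w) y)
    \<le> 25/4 * (197/200) ^ n / ((x + 3/2) * (y + 3/2))"
  using assms
proof (induction n arbitrary: x y)
  case 0
  \<comment> \<open>This maximum is the source of the constant 25/4.\<close>
  then have "(x + 3/2) * (y + 3/2) \<le> 5/2 * (5/2)" by (intro mult_mono) auto
  moreover have "0 < (x + 3/2) * (y + 3/2)" using 0 by simp
  ultimately show ?case by simp
next
  case (Suc n)
  let ?c = "25/4 * (197/200) ^ n :: real"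
  let ?p = "\<lambda>b. digit b + x" and ?q = "\<lambda>b. digit (\<not> b) + y"
  have pos: "?p b > 0" "?q b > 0" for b
    using Suc.prems digit_bounds(3)[of b] digit_bounds(3)[of "\<not> b"] by simp_all
  have step: "(\<Sum>w | length w = n. contr (b # w) x * contr (map Not (b # w)) y)
      \<le> ?c * (1 / ((1 + 3/2 * ?p b) * (1 + 3/2 * ?q b)))" for b
  proof -
    have "(\<Sum>w | length w = n. contr (b # w) x * contr (map Not (b # w)) y)
        = (\<Sum>w | length w = n. contr w (1 / ?p b) * contr (map Not w) (1 / ?q b)) / (?p b * ?q b)"
      by (simp add: sum_divide_distrib)
    also have "\<dots> \<le> ?c / ((1 / ?p b + 3/2) * (1 / ?q b + 3/2)) / (?p b * ?q b)"
      using pos[of b] by (intro divide_right_mono Suc.IH branch_mem Suc.prems) simp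
    also have "\<dots> = ?c / (((1 / ?p b + 3/2) * ?p b) * ((1 / ?q b + 3/2) * ?q b))"
      by (simp add: mult_ac)
    also have "(1 / ?p b + 3/2) * ?p b = 1 + 3/2 * ?p b"
      using pos(1)[of b] by (simp add: distrib_right)
    also have "(1 / ?q b + 3/2) * ?q b = 1 + 3/2 * ?q b"
      using pos(2)[of b] by (simp add: distrib_right)
    finally show ?thesis by simp
  qed
  have "(\<Sum>w | length w = Suc n. contr w x * contr (map Not w) y)
      \<le> ?c * (1 / ((1 + 3/2 * ?p True) * (1 + 3/2 * ?q True)))
        + ?c * (1 / ((1 + 3/2 * ?p False) * (1 + 3/2 * ?q False)))"
    unfolding sum_words_Suc by (rule add_mono[OF step step])
  also have "\<dots> = ?c * (1 / ((7/4 + 3/2 * x) * (5/2 + 3/2 * y))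
        + 1 / ((5/2 + 3/2 * x) * (7/4 + 3/2 * y)))"
    by (simp add: digit_def distrib_left)
  also have "\<dots> \<le> ?c * ((197/200) / ((x + 3/2) * (y + 3/2)))"
    by (rule mult_left_mono[OF mixed_weight_bound[OF Suc.prems]]) simp
  finally show ?case by simp
qed

section \<open>Distances inside cylinders and to their end points\<close>

lemma cyl_map_between:
  assumes "0 \<le> s" "s \<le> u" "u \<le> t"
  shows "cyl_map w u \<in> closed_segment (cyl_map w s) (cyl_map w t)"
proof -
  define P Q where "P = (u - s) * (contr w u * contr w s)" and "Q = (t - u) * (contr w t * contr w u)"
  have "0 \<le> P" "0 \<le> Q"
    using assms by (auto simp: P_def Q_def intro!: mult_nonneg_nonneg contr_nonneg)
  moreover have "cyl_map w u - cyl_map w s = (-1) ^ length w * P"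
      "cyl_map w t - cyl_map w u = (-1) ^ length w * Q"
    using assms by (simp_all only: cyl_map_diff P_def Q_def mult.assoc)
  ultimately show ?thesis
    by (cases "even (length w)") (auto simp: closed_segment_eq_real_ivl)
qed

lemma cyl_map_onto_segment:
  assumes "0 \<le> s" "s \<le> t" "y \<in> closed_segment (cyl_map w s) (cyl_map w t)"
  shows "y \<in> cyl_map w ` {s..t}"
proof -
  have c: "continuous_on {s..t} (cyl_map w)"
    using assms(1) by (intro continuous_on_subset[OF continuous_on_cyl_map]) auto
  show ?thesis
    using assms(3) IVT'[OF _ _ assms(2) c, of y] IVT2'[OF _ _ assms(2) c, of y]
    by (auto simp: closed_segment_eq_real_ivl split: if_splits)
qed

text \<open>To leave the cylinder, y has to pass one of its end points. The exact distance formula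
  bounds the distance to both end points from below, as \<open>contr w\<close> is smallest at
  1.\<close>

lemma cyl_map_escape:
  assumes "0 \<le> e" "1/2 + e \<le> s" "s \<le> 1 - e" "y \<notin> cyl_map w ` {1/2..1}"
  shows "e * (contr w 1)\<^sup>2 \<le> \<bar>y - cyl_map w s\<bar>"
proof -
  have far: "e * (contr w 1)\<^sup>2 \<le> \<bar>cyl_map w s - cyl_map w r\<bar>" if "r \<in> {1/2, 1}" for r
  proof -
    have "e * contr w 1 * contr w 1 \<le> \<bar>s - r\<bar> * contr w s * contr w r"
      using assms that contr_bounds(1)[of s w] contr_bounds(1)[of r w]
      by (intro mult_mono mult_nonneg_nonneg) (auto intro: contr_nonneg)
    then show ?thesis
      using cyl_map_dist[of s r w] assms that by (auto simp: power2_eq_square mult.assoc)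
  qed
  have "cyl_map w s \<in> closed_segment (cyl_map w (1/2)) (cyl_map w 1)"
    using assms by (intro cyl_map_between) auto
  moreover have "y \<notin> closed_segment (cyl_map w (1/2)) (cyl_map w 1)"
    using assms(4) cyl_map_onto_segment[of "1/2" 1 y w] by auto
  ultimately show ?thesis
    using far[of "1/2"] far[of 1] by (auto simp: closed_segment_eq_real_ivl split: if_splits)
qed

text \<open>The factor 4 is the square of the distortion constant.\<close>

lemma cyl_map_dist_contr:
  assumes "s \<in> {1/2..1}" "t \<in> {1/2..1}"
  shows "\<bar>cyl_map w s - cyl_map w t\<bar> \<le> 4 * \<bar>s - t\<bar> * (contr w 1)\<^sup>2"
proof -
  have "\<bar>s - t\<bar> * contr w s * contr w t \<le> \<bar>s - t\<bar> * (2 * contr w 1) * (2 * contr w 1)"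
    using assms contr_bounds(2)[of s w] contr_bounds(2)[of t w]
    by (intro mult_mono mult_nonneg_nonneg) (auto intro: contr_nonneg)
  then show ?thesis
    using cyl_map_dist[of s t w] assms by (auto simp: power2_eq_square mult_ac)
qed

section \<open>Exceptional sets and Borel-Cantelli\<close>

lemma measure_closed_segment_real: "measure lborel (closed_segment a b) = \<bar>a - b\<bar>" for a b :: real
  by (auto simp: closed_segment_eq_real_ivl)

text \<open>Unordered segments, since \<open>cyl_map w\<close> preserves or reverses the order
  according to the parity of the length.\<close>

definition segment :: "bool list \<Rightarrow> real \<Rightarrow> real \<Rightarrow> real set" where
  "segment w s t = closed_segment (cyl_map w s) (cyl_map w t)"

text \<open>As \<open>contr w 1\<close> is comparable to the square root of the cylinder length, the
  factor is squared when lengths are compared.\<close>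

definition long_image :: "nat \<Rightarrow> bool list set" where
  "long_image n = {w. length w = n \<and> contr (map Not w) 1 > (99/100) ^ n * contr w 1}"

definition margin :: "nat \<Rightarrow> real" where
  "margin n = (99/100) ^ n / 2"

definition exceptional :: "nat \<Rightarrow> real set" where
  "exceptional n = (\<Union>w\<in>long_image n. segment w (1/2) 1)
    \<union> (\<Union>w\<in>{w. length w = n}. segment w (1/2) (1/2 + margin n) \<union> segment w (1 - margin n) 1)"

lemma margin_bounds: "0 < margin n" "margin n \<le> 1/2"
  by (auto simp: margin_def power_le_one)

lemma segment_sets [simp]: "segment w s t \<in> sets borel"
  by (simp add: segment_def closed_segment_eq_real_ivl)

lemma finite_long_image: "finite (long_image n)"
  by (rule finite_subset[OF _ finite_words[of n]]) (auto simp: long_image_def)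

lemma measure_segment_le:
  assumes "s \<in> {1/2..1}" "t \<in> {1/2..1}"
  shows "measure lborel (segment w s t) \<le> 4 * \<bar>s - t\<bar> * (contr w 1)\<^sup>2"
  using cyl_map_dist_contr[OF assms] by (simp add: segment_def measure_closed_segment_real)

lemma exceptional_sets: "exceptional n \<in> sets borel"
  unfolding exceptional_def
  by (intro sets.Un sets.finite_UN finite_long_image finite_words segment_sets)

lemma emeasure_exceptional: "emeasure lborel (exceptional n) < \<infinity>"
proof -
  have "bounded (exceptional n)"
    unfolding exceptional_def segment_def
    by (auto simp: bounded_Un intro!: bounded_UN finite_long_image finite_words bounded_closed_segment)
  then show ?thesis by (rule emeasure_bounded_finite)
qed

text \<open>For a word in \<open>long_image n\<close>, \<open>(contr w 1)\<^sup>2\<close> is at most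
  \<open>(100/99) ^ n\<close> times the mixed product, and
  \<open>100/99 * (197/200) = 197/198\<close> is still below 1. The end pieces take up a share of
  order \<open>margin n\<close> of each cylinder.\<close>

lemma measure_exceptional_le:
  "measure lborel (exceptional n) \<le> 2 * (197/198) ^ n + 4 * (99/100) ^ n"
proof -
  have "measure lborel (\<Union>w\<in>long_image n. segment w (1/2) 1)
      \<le> (\<Sum>w\<in>long_image n. measure lborel (segment w (1/2) 1))"
    by (rule measure_UNION_le) (simp_all add: finite_long_image)
  also have "\<dots> \<le> (\<Sum>w\<in>long_image n. 2 * (100/99) ^ n * (contr w 1 * contr (map Not w) 1))"
  proof (rule sum_mono)
    fix w assume "w \<in> long_image n"
    then have "contr w 1 * ((99/100) ^ n * contr w 1) \<le> contr w 1 * contr (map Not w) 1"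
      using contr_pos[of 1 w] by (intro mult_left_mono) (auto simp: long_image_def)
    then have "(100/99) ^ n * (contr w 1 * ((99/100) ^ n * contr w 1))
        \<le> (100/99) ^ n * (contr w 1 * contr (map Not w) 1)"
      by (rule mult_left_mono) simp
    moreover have "(100/99) ^ n * (99/100) ^ n = (1::real)"
      by (simp add: power_mult_distrib[symmetric])
    then have "(100/99) ^ n * (contr w 1 * ((99/100) ^ n * contr w 1)) = (contr w 1)\<^sup>2"
      by (simp add: power2_eq_square mult_ac)
    ultimately show "measure lborel (segment w (1/2) 1)
        \<le> 2 * (100/99) ^ n * (contr w 1 * contr (map Not w) 1)"
      using measure_segment_le[of "1/2" 1 w] by simp
  qed
  also have "\<dots> \<le> (\<Sum>w | length w = n. 2 * (100/99) ^ n * (contr w 1 * contr (map Not w) 1))"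
    by (intro sum_mono2 finite_words mult_nonneg_nonneg)
      (auto simp: long_image_def less_imp_le contr_pos)
  also have "\<dots> = 2 * (100/99) ^ n * (\<Sum>w | length w = n. contr w 1 * contr (map Not w) 1)"
    by (simp add: sum_distrib_left)
  \<comment> \<open>At \<open>x = y = 1\<close> the weight is 4/25 and cancels the constant
    25/4.\<close>
  also have "\<dots> \<le> 2 * (100/99) ^ n * (197/200) ^ n"
    using sum_contr_Not_le[of 1 1 n] by (intro mult_left_mono) auto
  also have "\<dots> = 2 * (197/198) ^ n"
    by (simp add: power_mult_distrib[symmetric])
  finally have long: "measure lborel (\<Union>w\<in>long_image n. segment w (1/2) 1) \<le> 2 * (197/198) ^ n" .
  let ?U = "\<lambda>w. segment w (1/2) (1/2 + margin n) \<union> segment w (1 - margin n) 1"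
  have "measure lborel (\<Union>w\<in>{w. length w = n}. ?U w) \<le> (\<Sum>w | length w = n. measure lborel (?U w))"
    by (rule measure_UNION_le) (simp_all add: finite_words sets.Un)
  also have "\<dots> \<le> (\<Sum>w | length w = n. 4 * (99/100) ^ n * (contr w 1)\<^sup>2)"
  proof (rule sum_mono)
    fix w
    have "measure lborel (?U w) \<le> measure lborel (segment w (1/2) (1/2 + margin n))
        + measure lborel (segment w (1 - margin n) 1)"
      by (rule measure_Un_le) simp_all
    also have "\<dots> \<le> 4 * margin n * (contr w 1)\<^sup>2 + 4 * margin n * (contr w 1)\<^sup>2"
      using measure_segment_le[of "1/2" "1/2 + margin n" w]
        measure_segment_le[of "1 - margin n" 1 w] margin_bounds[of n] by simp
    also have "\<dots> = 4 * (99/100) ^ n * (contr w 1)\<^sup>2"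
      by (simp add: margin_def)
    finally show "measure lborel (?U w) \<le> 4 * (99/100) ^ n * (contr w 1)\<^sup>2" .
  qed
  also have "\<dots> = 4 * (99/100) ^ n * (\<Sum>w | length w = n. (contr w 1)\<^sup>2)"
    by (simp add: sum_distrib_left)
  also have "\<dots> \<le> 4 * (99/100) ^ n * 1"
    using sum_contr_sq_le[of 1 n] by (intro mult_left_mono) auto
  finally have ends: "measure lborel (\<Union>w\<in>{w. length w = n}. ?U w) \<le> 4 * (99/100) ^ n" by simp
  have "measure lborel (exceptional n) \<le> measure lborel (\<Union>w\<in>long_image n. segment w (1/2) 1)
      + measure lborel (\<Union>w\<in>{w. length w = n}. ?U w)"
    unfolding exceptional_def
    by (rule measure_Un_le; unfold sets_lborel;
        intro sets.finite_UN sets.Un finite_long_image finite_words segment_sets)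
  then show ?thesis using long ends by linarith
qed

lemma AE_eventually_not_exceptional:
  "AE x in lborel. \<forall>\<^sub>F n in sequentially. x \<notin> exceptional n"
proof -
  have "summable (\<lambda>n. 2 * (197/198) ^ n + 4 * (99/100) ^ n :: real)"
    by (intro summable_add summable_mult summable_geometric) auto
  then have "summable (\<lambda>n. measure lborel (exceptional n))"
    by (rule summable_comparison_test[rotated]) (use measure_exceptional_le in auto)
  from borel_cantelli_AE1[OF exceptional_sets[folded sets_lborel] emeasure_exceptional this]
  show ?thesis by simp
qed

section \<open>Vanishing of the derivative\<close>

lemma not_exceptional:
  assumes "s \<in> {1/2..1}" "cyl_map w s \<notin> exceptional (length w)"
  shows "contr (map Not w) 1 \<le> (99/100) ^ length w * contr w 1"
    and "1/2 + margin (length w) \<le> s" "s \<le> 1 - margin (length w)"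
proof -
  have "cyl_map w s \<in> segment w (1/2) 1"
    unfolding segment_def using assms(1) by (intro cyl_map_between) auto
  then have "w \<notin> long_image (length w)" using assms(2) by (auto simp: exceptional_def)
  then show "contr (map Not w) 1 \<le> (99/100) ^ length w * contr w 1"
    by (simp add: long_image_def)
  show "1/2 + margin (length w) \<le> s"
  proof (rule ccontr)
    assume "\<not> ?thesis"
    then have "cyl_map w s \<in> segment w (1/2) (1/2 + margin (length w))"
      unfolding segment_def using assms(1) by (intro cyl_map_between) auto
    then show False using assms(2) by (auto simp: exceptional_def)
  qed
  show "s \<le> 1 - margin (length w)"
  proof (rule ccontr)
    assume "\<not> ?thesis"
    then have "cyl_map w s \<in> segment w (1 - margin (length w)) 1"
      unfolding segment_def using assms(1) margin_bounds[of "length w"]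
      by (intro cyl_map_between) auto
    then show False using assms(2) by (auto simp: exceptional_def)
  qed
qed

text \<open>The images lie in the cylinder of \<open>map Not w\<close>, shorter by the order of
  \<open>(99/100) ^ (2 * n)\<close>, while the margin at stage \<open>Suc n\<close> costs only one
  factor \<open>(99/100) ^ Suc n\<close> in the distance from x to y.\<close>

lemma inversor_increment_le:
  assumes w: "length w = n" and s: "s \<in> {1/2..1}" "cyl_map w s = x"
    and t: "t \<in> {1/2..1}" "cyl_map (b # w) t = x"
    and x: "x \<notin> exceptional n" "x \<notin> exceptional (Suc n)"
    and y: "y \<in> cyl_map w ` {1/2..1}" "y \<notin> cyl_map (b # w) ` {1/2..1}"
  shows "\<bar>inversor y - inversor x\<bar> \<le> 17 * (99/100) ^ n * \<bar>y - x\<bar>"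
proof -
  define k where "k = contr w 1"
  have k: "0 < k" by (simp add: k_def contr_pos)
  obtain u where u: "u \<in> {1/2..1}" "y = cyl_map w u" using y(1) by blast
  have "\<bar>inversor y - inversor x\<bar>
      = \<bar>cyl_map (map Not w) (inversor u) - cyl_map (map Not w) (inversor s)\<bar>"
    using u s by (auto simp: inversor_cyl_map)
  also have "\<dots> \<le> 4 * \<bar>inversor u - inversor s\<bar> * (contr (map Not w) 1)\<^sup>2"
    using u s inversor_mem by (intro cyl_map_dist_contr) auto
  also have "\<dots> \<le> 4 * (1/2) * ((99/100) ^ n * k)\<^sup>2"
  proof (intro mult_mono power_mono)
    show "\<bar>inversor u - inversor s\<bar> \<le> 1/2"
      using inversor_mem[OF u(1)] inversor_mem[OF s(1)]
      unfolding abs_le_iff atLeastAtMost_iff by linarith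
    show "contr (map Not w) 1 \<le> (99/100) ^ n * k"
      using not_exceptional(1)[of s w] s x(1) w by (simp add: k_def)
  qed (auto simp: contr_pos less_imp_le)
  finally have num: "\<bar>inversor y - inversor x\<bar> \<le> 2 * ((99/100) ^ n * k)\<^sup>2"
    by simp
  have "(99/100) ^ Suc n / 2 * (k / 2)\<^sup>2 \<le> margin (Suc n) * (contr (b # w) 1)\<^sup>2"
    unfolding margin_def using contr_Cons_ge[of w b] k
    by (intro mult_left_mono power_mono) (simp_all add: k_def mult.commute del: contr.simps)
  also have "\<dots> \<le> \<bar>y - cyl_map (b # w) t\<bar>"
    using not_exceptional(2,3)[of t "b # w"] t x(2) y(2) w margin_bounds[of "Suc n"]
    by (intro cyl_map_escape) (auto simp del: cyl_map.simps)
  finally have den: "(99/100) ^ Suc n / 2 * (k / 2)\<^sup>2 \<le> \<bar>y - x\<bar>"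
    by (simp only: t(2))
  \<comment> \<open>The quotient of the two bounds is \<open>16 / (99/100)\<close> times
    \<open>(99/100) ^ n\<close>, and 17 exceeds this constant.\<close>
  have "2 * ((99/100) ^ n * k)\<^sup>2 \<le> 17 * (99/100) ^ n * ((99/100) ^ Suc n / 2 * (k / 2)\<^sup>2)"
  proof -
    have "0 \<le> (99/100) ^ n * (99/100) ^ n * (k * k)" by simp
    then show ?thesis by (simp add: power2_eq_square mult_ac)
  qed
  also have "\<dots> \<le> 17 * (99/100) ^ n * \<bar>y - x\<bar>"
    by (rule mult_left_mono[OF den]) simp
  finally show ?thesis using num by simp
qed

text \<open>Every y close to x leaves the cylinders around x at some late stage, to which the
  increment bound of that stage applies.\<close>

lemma inversor_has_derivative_0:
  assumes x: "x \<in> {1/2..1}" and ev: "\<forall>\<^sub>F n in sequentially. x \<notin> exceptional n"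
  shows "(inversor has_real_derivative 0) (at x within {1/2..1})"
proof -
  define W where "W = prefix_word (expand x)"
  have W: "length (W n) = n" "W (Suc n) = expand x (Suc n) # W n"
      "cyl_map (W n) (tail x n) = x" for n
    unfolding W_def using cyl_map_tail[OF x] by auto
  obtain N where N: "\<And>n. n \<ge> N \<Longrightarrow> x \<notin> exceptional n"
    using ev by (auto simp: eventually_sequentially)
  have incr: "\<bar>inversor y - inversor x\<bar> \<le> 17 * (99/100) ^ n * \<bar>y - x\<bar>"
    if "n \<ge> N" "y \<in> cyl_map (W n) ` {1/2..1}" "y \<notin> cyl_map (W (Suc n)) ` {1/2..1}" for n y
  proof -
    have x': "cyl_map (expand x (Suc n) # W n) (tail x (Suc n)) = x"
      using W(3)[of "Suc n"] by (simp only: W(2))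
    show ?thesis
      by (rule inversor_increment_le[OF W(1) tail_mem[OF x, of n] W(3) tail_mem[OF x, of "Suc n"] x'])
        (use that N in \<open>simp_all only: W(2) le_SucI not_False_eq_True\<close>)
  qed
  show ?thesis
    unfolding has_field_derivative_iff
  proof (rule tendstoI)
    fix e :: real assume "e > 0"
    have "(\<lambda>n. 17 * (99/100) ^ n :: real) \<longlonglongrightarrow> 0"
      by (auto intro!: tendsto_eq_intros LIMSEQ_realpow_zero)
    from order_tendstoD(2)[OF this \<open>e > 0\<close>] obtain K where
      K: "\<And>n. n \<ge> K \<Longrightarrow> 17 * (99/100) ^ n < e"
      by (auto simp: eventually_sequentially)
    define M where "M = max N K"
    have M: "M \<ge> N" "17 * (99/100) ^ M < e"
      using K[of M] by (simp_all add: M_def)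
    \<comment> \<open>By \<open>cyl_map_escape\<close>, points closer to x than d lie in the
      cylinder of stage M.\<close>
    define d where "d = margin M * (contr (W M) 1)\<^sup>2"
    have "d > 0" 
      unfolding d_def by (intro mult_pos_pos margin_bounds zero_less_power contr_pos) simp
    moreover have "dist ((inversor y - inversor x) / (y - x)) 0 < e"
      if y: "y \<in> {1/2..1}" "y \<noteq> x" "dist y x < d" for y
    proof -
      have inM: "y \<in> cyl_map (W M) ` {1/2..1}"
      proof (rule ccontr)
        assume "\<not> ?thesis"
        then have "d \<le> \<bar>y - cyl_map (W M) (tail x M)\<bar>"
          unfolding d_def
          using not_exceptional(2,3)[of "tail x M" "W M"] tail_mem[OF x] N[OF M(1)] W(1,3)[of M]
            margin_bounds[of M]
          by (intro cyl_map_escape) auto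
        then show False using y(3) W(3)[of M] by (simp add: dist_real_def)
      qed
      \<comment> \<open>Otherwise y would lie in all cylinders from stage M on, which shrink to
        x.\<close>
      have "\<exists>n\<ge>M. y \<in> cyl_map (W n) ` {1/2..1} \<and> y \<notin> cyl_map (W (Suc n)) ` {1/2..1}"
      proof (rule ccontr)
        assume *: "\<not> ?thesis"
        have all: "y \<in> cyl_map (W n) ` {1/2..1}" if "n \<ge> M" for n
          using that by (induction rule: dec_induct) (use inM * in auto)
        have "\<bar>y - x\<bar> \<le> 9 * (81/100) ^ n" if n: "n \<ge> M" for n
        proof -
          obtain u where "u \<in> {1/2..1}" "y = cyl_map (W n) u" using all[OF n] by blast
          then show ?thesis
            using cyl_map_dist_le_unit[OF _ tail_mem[OF x, of n], of u "W n"] W(1,3)[of n] by simp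
        qed
        then have "\<bar>y - x\<bar> \<le> 0"
          by (intro LIMSEQ_le_const[OF cyl_bound_LIMSEQ]) auto
        then show False using y(2) by simp
      qed
      then obtain n where n: "n \<ge> M" "\<bar>inversor y - inversor x\<bar> \<le> 17 * (99/100) ^ n * \<bar>y - x\<bar>"
        using incr M(1) by (meson le_trans)
      have "(99/100) ^ n \<le> ((99/100) ^ M :: real)"
        using n(1) by (intro power_decreasing) auto
      then have lt: "17 * (99/100) ^ n < e" using M(2) by linarith
      have "\<bar>inversor y - inversor x\<bar> / \<bar>y - x\<bar> \<le> 17 * (99/100) ^ n"
        using n(2) y(2) by (simp add: divide_le_eq)
      then show ?thesis using lt by (simp add: abs_divide)
    qed
    ultimately show "\<forall>\<^sub>F y in at x within {1/2..1}. dist ((inversor y - inversor x) / (y - x)) 0 < e"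
      unfolding eventually_at by blast
  qed
qed

text \<open>The first two conjuncts certify that the definite description in \<open>inversor\<close>
  denotes the intended map.\<close>

theorem mainTheorem6:
  shows "inversor \<in> {1/2..1} \<rightarrow> {1/2..1}
    \<and> (\<forall>\<alpha>\<in>binary_seqs. inversor (Delta_A2 \<alpha>) = Delta_A2 (\<lambda>n. 1 - \<alpha> n))
    \<and> singular_on {1/2..1} inversor"
proof (intro conjI)
  show "inversor \<in> {1/2..1} \<rightarrow> {1/2..1}"
    using inversor_mem by blast
  show "\<forall>\<alpha>\<in>binary_seqs. inversor (Delta_A2 \<alpha>) = Delta_A2 (\<lambda>n. 1 - \<alpha> n)"
  proof
    fix \<alpha> :: "nat \<Rightarrow> nat" assume "\<alpha> \<in> binary_seqs"
    from Delta_A2_eq[OF this] show "inversor (Delta_A2 \<alpha>) = Delta_A2 (\<lambda>n. 1 - \<alpha> n)"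
      by (simp only: inversor_expansion)
  qed
  have "\<not> inversor constant_on {1/2..1}"
    using inversor_ends unfolding constant_on_def by force
  moreover have "AE x in lebesgue. x \<in> {1/2..1}
      \<longrightarrow> (inversor has_real_derivative 0) (at x within {1/2..1})"
    using AE_completion[OF AE_eventually_not_exceptional]
    by eventually_elim (use inversor_has_derivative_0 in blast)
  ultimately show "singular_on {1/2..1} inversor"
    unfolding singular_on_def using continuous_on_inversor by blast
qed

end
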